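(* There exist self-similar measures $\mu$ on $[0,1]$ which are spectral and thick and satisfy $1/2<\dim_{\mathrm{H}}\mu<1$.
   Context: A self-similar measure on $\mathbb{R}$ is the unique Borel probability measure $\mu$ with $\mu=\sum_{i=1}^lp_i\,(f_i)_*\mu$, where $l\ge2$, $f_i(x)=r_ix+t_i$ with $r_i\in(0,1)$, $t_i\in\mathbb{R}$, and $(p_i)$ a positive probability vector. $\dim_{\mathrm{H}}\mu$ is the $\mu$-a.e. value of $\lim_{\delta\to0}\log\mu(B(x,\delta))/\log\delta$. For $\xi\in\mathbb{Z}$, $\hat\mu(\xi)=\int e^{-2\pi ix\xi}d\mu(x)$; $\dim_{l^2}\mu=\sup\{s>0:\sum_{|\xi|\le R}|\hat\mu(\xi)|^2\ll R^{1-s}\}$. $\mu$ is spectral if there exist $\Delta>1/2$, $\lambda>0$ with $\#\{\xi\in\mathbb{Z}\cap[0,N]:|\hat\mu(\xi)|\ge|\xi|^{-\Delta}\}\ll N^{1-\lambda}$; the supremum of such $\lambda$ is $\dim_{\mathrm{R}}\mu$; $\mu$ is thick if $\dim_{l^2}\mu+\dim_{\mathrm{R}}\mu>1$. *)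

theory Defs
  imports "HOL-Probability.Probability" "HOL-Library.Landau_Symbols"
begin

text \<open>
  By Hutchinson's theorem the stationarity equation has exactly one Borel probability solution
  for given \<open>l, r, t, p\<close>, so the predicate below determines \<open>\<mu>\<close> from these data.
\<close>

definition self_similar_measure_of ::
    "nat \<Rightarrow> (nat \<Rightarrow> real) \<Rightarrow> (nat \<Rightarrow> real) \<Rightarrow> (nat \<Rightarrow> real) \<Rightarrow> real measure \<Rightarrow> bool" where
  "self_similar_measure_of l r t p \<mu> \<longleftrightarrow>
     2 \<le> l \<and> (\<forall>i<l. 0 < r i \<and> r i < 1 \<and> 0 < p i) \<and> (\<Sum>i<l. p i) = 1 \<and>
     prob_space \<mu> \<and> sets \<mu> = sets borel \<and>
     (\<forall>A\<in>sets borel. measure \<mu> A =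
        (\<Sum>i<l. p i * measure (distr \<mu> borel (\<lambda>x. r i * x + t i)) A))"

definition self_similar_measure :: "real measure \<Rightarrow> bool" where
  "self_similar_measure \<mu> \<longleftrightarrow> (\<exists>l r t p. self_similar_measure_of l r t p \<mu>)"

text \<open>
  The dimension is a relation rather than a function, so that asserting it includes the
  almost sure existence of the limit. For a probability measure there is at most one such \<open>d\<close>.
\<close>

definition has_dim_H :: "real measure \<Rightarrow> real \<Rightarrow> bool" where
  "has_dim_H \<mu> d \<longleftrightarrow>
     (AE x in \<mu>. ((\<lambda>\<delta>. ln (measure \<mu> (ball x \<delta>)) / ln \<delta>) \<longlongrightarrow> d) (at_right 0))"

definition fourier :: "real measure \<Rightarrow> int \<Rightarrow> complex" where
  "fourier \<mu> \<xi> =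
     (LINT x|\<mu>. exp (- 2 * complex_of_real pi * \<i> * complex_of_real x * of_int \<xi>))"

text \<open>
  In both suprema below, \<open>insert 0\<close> only gives the supremum of an empty set of positive reals the
  value \<open>0\<close>; both sets are bounded above by \<open>1\<close> for probability measures.
\<close>

definition dim_l2 :: "real measure \<Rightarrow> real" where
  "dim_l2 \<mu> = Sup (insert 0 {s. 0 < s \<and>
     (\<lambda>R::real. \<Sum>\<xi> | \<bar>real_of_int \<xi>\<bar> \<le> R. (cmod (fourier \<mu> \<xi>))\<^sup>2)
       \<in> O[at_top](\<lambda>R. R powr (1 - s))})"

text \<open>
  Since \<open>0 powr _ = 0\<close>, the frequency \<open>\<xi> = 0\<close> is always counted here. This changes the count by
  at most one, hence is irrelevant for \<open>\<kappa> \<le> 1\<close>.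
\<close>

definition spectral_exponent :: "real measure \<Rightarrow> real \<Rightarrow> bool" where
  "spectral_exponent \<mu> \<kappa> \<longleftrightarrow> 0 < \<kappa> \<and>
     (\<exists>\<Delta>>1/2.
        (\<lambda>N::nat. real (card {\<xi>::int. 0 \<le> \<xi> \<and> \<xi> \<le> int N \<and>
                              cmod (fourier \<mu> \<xi>) \<ge> \<bar>real_of_int \<xi>\<bar> powr (- \<Delta>)}))
          \<in> O[at_top](\<lambda>N. real N powr (1 - \<kappa>)))"

definition spectral :: "real measure \<Rightarrow> bool" where
  "spectral \<mu> \<longleftrightarrow> (\<exists>\<kappa>. spectral_exponent \<mu> \<kappa>)"

definition dim_R :: "real measure \<Rightarrow> real" where
  "dim_R \<mu> = Sup (insert 0 {\<kappa>. spectral_exponent \<mu> \<kappa>})"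

definition thick :: "real measure \<Rightarrow> bool" where
  "thick \<mu> \<longleftrightarrow> dim_l2 \<mu> + dim_R \<mu> > 1"

end

theory Submission imports Defs begin

text \<open>
  Take the uniform measure on base \<open>b\<close> expansions with digits \<open>0, \<dots>, m - 1\<close>, where \<open>m = b - 1\<close>.
  Every \<open>b\<close>-adic interval of order \<open>n\<close> has mass \<open>0\<close> or \<open>m ^ (-n)\<close>, so the dimension is
  \<open>ln m / ln b\<close>. The Fourier transform is an infinite product of normalised Dirichlet kernels, and
  the \<open>L\<^sup>1\<close> norm of the Dirichlet kernel grows only logarithmically. Hence
  the Fourier coefficients of frequency at most \<open>R\<close> have absolute sum \<open>O(R powr \<epsilon>)\<close>, with \<open>\<epsilon>\<close> of order \<open>ln (ln b) / ln b\<close>. Such a bound with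
  \<open>\<epsilon> < 1/4\<close> yields \<open>dim_l2 \<mu> \<ge> 1 - \<epsilon>\<close> and, by Chebyshev, \<open>dim_R \<mu> \<ge> 1 - \<epsilon> - \<Delta>\<close> for every
  \<open>\<Delta> > 1/2\<close>; the choice \<open>\<Delta> = 3/4 - \<epsilon>\<close> makes the sum exceed \<open>1\<close>.
\<close>

section \<open>The digit measure\<close>

text \<open>Reducing mod \<open>m\<close> makes the series converge for every stream, not only almost surely.\<close>

definition digit_sum :: "nat \<Rightarrow> nat \<Rightarrow> nat stream \<Rightarrow> real" where
  "digit_sum m b \<omega> = (\<Sum>n. real (\<omega> !! n mod m) / real b ^ Suc n)"

definition digit_measure :: "nat \<Rightarrow> nat \<Rightarrow> real measure" where
  "digit_measure m b =
     distr (stream_space (measure_pmf (pmf_of_set {..<m}))) borel (digit_sum m b)"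

text \<open>Independence of the first entry from the remaining stream, put as an image measure so
  that integrals can be split by Fubini. It is the source of the self-similarity.\<close>

lemma (in prob_space) stream_space_eq_distr_Stream:
  "stream_space M = distr (M \<Otimes>\<^sub>M stream_space M) (stream_space M) (\<lambda>(x, \<omega>). x ## \<omega>)"
    (is "_ = ?D")
proof (rule measure_eqI)
  interpret S: prob_space "stream_space M" by (rule prob_space_stream_space)
  fix A assume [measurable]: "A \<in> sets (stream_space M)"
  have "emeasure ?D A = emeasure (M \<Otimes>\<^sub>M stream_space M)
      ((\<lambda>(x, \<omega>). x ## \<omega>) -` A \<inter> space (M \<Otimes>\<^sub>M stream_space M))"
    by (subst emeasure_distr) auto
  also have "\<dots> = (\<integral>\<^sup>+x. emeasure (stream_space M)
      (Pair x -` ((\<lambda>(x, \<omega>). x ## \<omega>) -` A \<inter> space (M \<Otimes>\<^sub>M stream_space M))) \<partial>M)"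
    by (rule S.emeasure_pair_measure_alt) measurable
  also have "\<dots> = emeasure (stream_space M) A"
    by (subst (2) emeasure_stream_space)
       (auto intro!: nn_integral_cong arg_cong[where f="emeasure _"] simp: space_pair_measure)
  finally show "emeasure (stream_space M) A = emeasure ?D A" ..
qed simp

locale digit_system =
  fixes m b :: nat
  assumes two_le_m: "2 \<le> m" and m_less_b: "m < b"
begin

abbreviation "digits \<equiv> measure_pmf (pmf_of_set {..<m})"
abbreviation "digit_space \<equiv> stream_space digits"
abbreviation "\<mu> \<equiv> digit_measure m b"

lemma b_ge: "3 \<le> b" "1 < real b" "0 < real b" "b \<noteq> 0" "0 < b"
  and m_ge: "0 < m" "0 < real m" "1 < real m"
  using two_le_m m_less_b by auto

lemma digit_le: "real (k mod m) \<le> real m - 1"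
proof -
  have "k mod m \<le> m - 1" using m_ge(1) by (simp add: Suc_leI less_Suc_eq_le[symmetric])
  thus ?thesis using m_ge(1) by linarith
qed

lemma sums_digit_bound: "(\<lambda>n. (real m - 1) / real b ^ Suc n) sums ((real m - 1) / (real b - 1))"
proof -
  have "(\<lambda>n. (real m - 1) / real b * (1 / real b) ^ n) sums ((real m - 1) / real b * (1 / (1 - 1 / real b)))"
    by (intro sums_mult geometric_sums) (use b_ge in auto)
  also have "(real m - 1) / real b * (1 / (1 - 1 / real b)) = (real m - 1) / (real b - 1)"
    using b_ge by (simp add: field_simps)
  finally show ?thesis by (simp add: power_divide)
qed

lemma summable_digits: "summable (\<lambda>n. real (\<omega> !! n mod m) / real b ^ Suc n)"
  by (rule summable_comparison_test'[OF sums_summable[OF sums_digit_bound], of 0])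
     (auto intro!: divide_right_mono digit_le)

lemma digit_sum_nonneg: "0 \<le> digit_sum m b \<omega>"
  unfolding digit_sum_def by (intro suminf_nonneg summable_digits) auto

text \<open>The largest possible value is \<open>(m - 1) / (b - 1)\<close>. Strictness, which comes
  from \<open>m < b\<close>, makes the half-open cells with index in \<open>[0, b ^ n)\<close> carry
  all the mass.\<close>

lemma digit_sum_less_1: "digit_sum m b \<omega> < 1"
proof -
  have "digit_sum m b \<omega> \<le> (real m - 1) / (real b - 1)"
    unfolding digit_sum_def sums_unique[OF sums_digit_bound]
    by (intro suminf_le summable_digits sums_summable[OF sums_digit_bound] divide_right_mono digit_le) auto
  also have "\<dots> < 1" using b_ge m_less_b by simp
  finally show ?thesis .
qed

lemma digit_sum_Stream: "digit_sum m b (i ## \<omega>) = (digit_sum m b \<omega> + real (i mod m)) / real b"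
proof -
  have "digit_sum m b (i ## \<omega>) = real (i mod m) / real b + (\<Sum>n. real (\<omega> !! n mod m) / real b ^ Suc (Suc n))"
    unfolding digit_sum_def using suminf_split_head[OF summable_digits, of "i ## \<omega>"] by simp
  also have "(\<Sum>n. real (\<omega> !! n mod m) / real b ^ Suc (Suc n)) = digit_sum m b \<omega> / real b"
    unfolding digit_sum_def by (subst suminf_divide[OF summable_digits, symmetric]) (simp add: field_simps)
  finally show ?thesis by (simp add: add_divide_distrib)
qed

lemma digit_sum_measurable [measurable]: "digit_sum m b \<in> borel_measurable digit_space"
  unfolding digit_sum_def[abs_def] by measurable

lemma sets_digit_measure [simp, measurable_cong]: "sets \<mu> = sets borel"
  and space_digit_measure [simp]: "space \<mu> = UNIV"
  by (simp_all add: digit_measure_def)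

sublocale \<mu>: real_distribution \<mu>
proof -
  interpret S: prob_space digit_space
    by (intro prob_space.prob_space_stream_space prob_space_measure_pmf)
  interpret prob_space \<mu>
    unfolding digit_measure_def by (rule S.prob_space_distr) simp
  show "real_distribution \<mu>" by unfold_locales auto
qed

lemma AE_unit_interval:
  assumes "\<And>x. 0 \<le> x \<Longrightarrow> x < 1 \<Longrightarrow> P x"
  shows "AE x in \<mu>. P x"
proof -
  have "AE x in \<mu>. 0 \<le> x \<and> x < 1"
    unfolding digit_measure_def
    by (subst AE_distr_iff) (auto simp: digit_sum_nonneg digit_sum_less_1)
  thus ?thesis by eventually_elim (use assms in auto)
qed

text \<open>Stationarity in integrated form: condition on the first digit, which is uniform on
  \<open>{..<m}\<close>. Indicators yield the self-similarity equation, exponentials the product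
  formula for the Fourier transform.\<close>

lemma integral_digit_measure:
  fixes h :: "real \<Rightarrow> 'a :: {banach, second_countable_topology}"
  assumes [measurable]: "h \<in> borel_measurable borel" and bound: "\<And>x. norm (h x) \<le> C"
  shows "(LINT x|\<mu>. h x) = (\<Sum>i<m. LINT x|\<mu>. h ((x + real i) / real b)) /\<^sub>R real m"
proof -
  interpret S: prob_space digit_space by (rule prob_space.prob_space_stream_space[OF prob_space_measure_pmf])
  interpret P: pair_prob_space digits digit_space ..
  have "(LINT x|\<mu>. h x) = (LINT \<omega>|digit_space. h (digit_sum m b \<omega>))"
    unfolding digit_measure_def by (rule integral_distr) auto
  also have "\<dots> = (LINT p|(digits \<Otimes>\<^sub>M digit_space). h (digit_sum m b (fst p ## snd p)))"
    by (subst prob_space.stream_space_eq_distr_Stream[OF prob_space_measure_pmf], subst integral_distr)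
       (auto simp: case_prod_beta)
  also have "\<dots> = (LINT i|digits. LINT \<omega>|digit_space. h (digit_sum m b (i ## \<omega>)))"
    by (subst P.integral_fst'[symmetric])
       (auto intro!: P.integrable_const_bound[of _ C] simp: bound)
  also have "\<dots> = (LINT i|digits. LINT x|\<mu>. h ((x + real (i mod m)) / real b))"
    unfolding digit_measure_def by (subst integral_distr) (auto simp: digit_sum_Stream)
  also have "\<dots> = (\<Sum>i<m. (LINT x|\<mu>. h ((x + real (i mod m)) / real b)) /\<^sub>R real m)"
    using m_ge by (subst integral_measure_pmf[of "{..<m}"]) (auto simp: lessThan_empty_iff divide_inverse)
  finally show ?thesis by (simp add: scaleR_sum_right)
qed

lemma measure_digit_measure:
  assumes [measurable]: "A \<in> sets borel"
  shows "measure \<mu> A = (\<Sum>i<m. measure \<mu> {x. (x + real i) / real b \<in> A}) / real m"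
proof -
  have *: "(LINT x|\<mu>. indicator A ((x + real i) / real b)) = measure \<mu> {x. (x + real i) / real b \<in> A}"
    for i
  proof -
    have "(LINT x|\<mu>. indicator A ((x + real i) / real b)) =
        (LINT x|\<mu>. indicat_real {x. (x + real i) / real b \<in> A} x)"
      by (rule Bochner_Integration.integral_cong) (auto simp: indicator_def)
    thus ?thesis by simp
  qed
  have "measure \<mu> A = (LINT x|\<mu>. indicat_real A x)" by simp
  also have "\<dots> = (\<Sum>i<m. LINT x|\<mu>. indicat_real A ((x + real i) / real b)) /\<^sub>R real m"
    by (rule integral_digit_measure[of _ 1]) (auto simp: indicator_def)
  finally show ?thesis unfolding * by (simp add: divide_inverse)
qed

lemma self_similar_digit_measure: "self_similar_measure \<mu>"
  unfolding self_similar_measure_def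
proof (intro exI)
  show "self_similar_measure_of m (\<lambda>_. 1 / real b) (\<lambda>i. real i / real b) (\<lambda>_. 1 / real m) \<mu>"
    unfolding self_similar_measure_of_def
  proof (intro conjI ballI)
    fix A :: "real set" assume "A \<in> sets borel"
    moreover have "(x + real i) / real b = 1 / real b * x + real i / real b" for i x
      by (simp add: add_divide_distrib)
    ultimately show "measure \<mu> A =
        (\<Sum>i<m. 1 / real m * measure (distr \<mu> borel (\<lambda>x. 1 / real b * x + real i / real b)) A)"
      by (subst measure_digit_measure)
         (simp_all add: measure_distr vimage_def sum_divide_distrib)
  qed (use two_le_m b_ge m_ge \<mu>.prob_space_axioms in auto)
qed

lemma measure_unit_interval: "measure \<mu> {0..1} = 1"
  by (subst \<mu>.prob_eq_1) (auto intro!: AE_unit_interval)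

section \<open>Masses of \<open>b\<close>-adic cells\<close>

lemma mem_cell_iff:
  "x \<in> {of_int k / real b ^ n..<(of_int k + 1) / real b ^ n} \<longleftrightarrow> \<lfloor>x * real b ^ n\<rfloor> = k"
  using b_ge by (auto simp: floor_eq_iff field_simps)

lemma measure_cell_outside:
  assumes "k < 0 \<or> k \<ge> int b ^ n"
  shows "measure \<mu> {of_int k / real b ^ n..<(of_int k + 1) / real b ^ n} = 0"
proof -
  have "x \<notin> {of_int k / real b ^ n..<(of_int k + 1) / real b ^ n}" if "0 \<le> x" "x < 1" for x
  proof
    assume "x \<in> {of_int k / real b ^ n..<(of_int k + 1) / real b ^ n}"
    hence "of_int k \<le> x * real b ^ n" "x * real b ^ n < of_int k + 1"
      using b_ge by (auto simp: field_simps)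
    moreover have "0 \<le> x * real b ^ n" using that by simp
    moreover have "x * real b ^ n < real b ^ n" using that b_ge by simp
    ultimately have "of_int k < real_of_int (int b ^ n)" "real_of_int k + 1 > 0" by auto
    hence "k < int b ^ n" "0 < k + 1" by linarith+
    thus False using assms by auto
  qed
  hence "AE x in \<mu>. x \<notin> {of_int k / real b ^ n..<(of_int k + 1) / real b ^ n}"
    by (rule AE_unit_interval)
  thus ?thesis by (subst \<mu>.prob_eq_0) auto
qed

text \<open>By stationarity, a cell of order \<open>n + 1\<close> pulls back under the
  \<open>i\<close>-th map to the cell of order \<open>n\<close> with index
  \<open>k - i * b ^ n\<close>. Only the leading digit \<open>i = k div b ^ n\<close> can bring this
  index into \<open>[0, b ^ n)\<close>, so at most one term survives and is divided by
  \<open>m\<close>.\<close>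

lemma measure_cell:
  "measure \<mu> {of_int k / real b ^ n..<(of_int k + 1) / real b ^ n} \<in> {0, 1 / real m ^ n}"
proof (induction n arbitrary: k)
  case 0
  show ?case
  proof (cases "k = 0")
    case True
    have "measure \<mu> {0..<1} = 1"
      by (subst \<mu>.prob_eq_1) (auto intro!: AE_unit_interval)
    thus ?thesis using True by simp
  next
    case False
    thus ?thesis using measure_cell_outside[of k 0] by force
  qed
next
  case (Suc n)
  define c where "c k = measure \<mu> {of_int k / real b ^ n..<(of_int k + 1) / real b ^ n}" for k :: int
  \<comment> \<open>For negative \<open>k\<close> this gives \<open>d = 0\<close>; the one remaining
    term is still covered by the induction hypothesis. For \<open>d \<ge> m\<close> the sum
    vanishes.\<close>
  define d where "d = nat (k div int b ^ n)"
  have "{x. (x + real i) / real b \<in> {of_int k / real b ^ Suc n..<(of_int k + 1) / real b ^ Suc n}}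
     = {of_int (k - int i * int b ^ n) / real b ^ n..<(of_int (k - int i * int b ^ n) + 1) / real b ^ n}" for i
  proof (intro set_eqI)
    fix x
    have "(x + real i) / real b * real b ^ Suc n = x * real b ^ n + of_int (int i * int b ^ n)"
      using b_ge by (simp add: field_simps)
    thus "x \<in> {x. (x + real i) / real b \<in> {of_int k / real b ^ Suc n..<(of_int k + 1) / real b ^ Suc n}}
      \<longleftrightarrow> x \<in> {of_int (k - int i * int b ^ n) / real b ^ n..<(of_int (k - int i * int b ^ n) + 1) / real b ^ n}"
      unfolding mem_Collect_eq mem_cell_iff by (simp only: floor_add_int[symmetric]) linarith
  qed
  hence "measure \<mu> {of_int k / real b ^ Suc n..<(of_int k + 1) / real b ^ Suc n}
      = (\<Sum>i<m. c (k - int i * int b ^ n)) / real m"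
    by (subst measure_digit_measure) (auto simp: c_def)
  also have "(\<Sum>i<m. c (k - int i * int b ^ n))
      = (\<Sum>i\<in>{..<m}. if i = d then c (k - int i * int b ^ n) else 0)"
  proof (intro sum.cong refl)
    fix i
    have "c (k - int i * int b ^ n) = 0" if "i \<noteq> d"
      unfolding c_def
    proof (rule measure_cell_outside, rule ccontr)
      assume "\<not> (k - int i * int b ^ n < 0 \<or> int b ^ n \<le> k - int i * int b ^ n)"
      hence "k div int b ^ n = int i"
        by (intro int_div_pos_eq[of _ _ _ "k - int i * int b ^ n"]) auto
      thus False using that by (simp add: d_def)
    qed
    thus "c (k - int i * int b ^ n) =
        (if i = d then c (k - int i * int b ^ n) else 0)" by auto
  qed
  finally show ?case
    using Suc.IH[of "k - int d * int b ^ n"] unfolding c_def[symmetric] by (cases "d < m") auto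
qed

end

section \<open>Local dimension\<close>

text \<open>Chooses the scale matching a radius or a frequency bound. Since
  \<open>1 \<le> R\<close>, the least power exceeding \<open>R\<close> has positive exponent, so it
  has a predecessor.\<close>

lemma ex_power_interval:
  fixes \<beta> R :: real
  assumes "1 < \<beta>" "1 \<le> R"
  obtains n where "\<beta> ^ n \<le> R" "R < \<beta> ^ Suc n"
proof -
  obtain N where "R < \<beta> ^ N" using real_arch_pow[OF assms(1)] by blast
  hence L: "R < \<beta> ^ (LEAST n. R < \<beta> ^ n)" by (rule LeastI)
  then obtain n where n: "(LEAST n. R < \<beta> ^ n) = Suc n"
    using assms(2) by (cases "LEAST n. R < \<beta> ^ n") auto
  have "\<not> R < \<beta> ^ n" by (rule not_less_Least) (simp add: n)
  thus ?thesis using that L n by (simp add: not_less)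
qed

context digit_system
begin

text \<open>There are only countably many cells, so almost every point avoids all null ones.\<close>

lemma AE_measure_cell:
  "AE x in \<mu>. \<forall>n k. x \<in> {of_int k / real b ^ n..<(of_int k + 1) / real b ^ n} \<longrightarrow>
     measure \<mu> {of_int k / real b ^ n..<(of_int k + 1) / real b ^ n} = 1 / real m ^ n"
proof (subst AE_all_countable, rule allI, subst AE_all_countable, rule allI)
  fix n :: nat and k :: int
  let ?C = "{of_int k / real b ^ n..<(of_int k + 1) / real b ^ n}"
  show "AE x in \<mu>. x \<in> ?C \<longrightarrow> measure \<mu> ?C = 1 / real m ^ n"
  proof (cases "measure \<mu> ?C = 0")
    case True
    hence "AE x in \<mu>. x \<notin> ?C" by (subst (asm) \<mu>.prob_eq_0) auto
    thus ?thesis by eventually_elim blast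
  next
    case False
    thus ?thesis using measure_cell[of k n] by simp
  qed
qed

text \<open>At a typical point, a ball of radius \<delta> with
  \<open>b ^ n \<le> 1 / \<delta> < b ^ Suc n\<close> lies in three cells of order \<open>n\<close>
  and contains the cell of order \<open>n + 1\<close> around its centre.\<close>

lemma has_dim_H_digit_measure: "has_dim_H \<mu> (ln (real m) / ln (real b))"
  unfolding has_dim_H_def using AE_measure_cell
proof eventually_elim
  case (elim x)
  let ?cell = "\<lambda>n k. {of_int k / real b ^ n..<(of_int k + 1) / real b ^ n}"
  let ?s = "ln (real m) / ln (real b)"
  have cell: "measure \<mu> (?cell n \<lfloor>x * real b ^ n\<rfloor>) = 1 / real m ^ n" for n
    using elim mem_cell_iff[of x "\<lfloor>x * real b ^ n\<rfloor>" n] by blast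
  \<comment> \<open>As \<open>ln \<delta> < 0\<close>, upper bounds on the mass become lower bounds
    on the quotient and vice versa. The constants \<open>ln 3\<close> and \<open>ln m\<close>
    account for the three cells and for the gap between orders \<open>n\<close> and
    \<open>n + 1\<close>.\<close>
  have bounds: "?s + (ln (real m) + ln 3) / ln \<delta> \<le> ln (measure \<mu> (ball x \<delta>)) / ln \<delta>"
    "ln (measure \<mu> (ball x \<delta>)) / ln \<delta> \<le> ?s - ln (real m) / ln \<delta>"
    if \<delta>: "0 < \<delta>" "\<delta> < 1" for \<delta> :: real
  proof -
    obtain n where n: "real b ^ n \<le> 1 / \<delta>" "1 / \<delta> < real b ^ Suc n"
      using ex_power_interval[of "real b" "1 / \<delta>"] b_ge \<delta> by auto
    have "ball x \<delta> \<subseteq> (\<Union>j\<in>{-1, 0, 1}. ?cell n (\<lfloor>x * real b ^ n\<rfloor> + j))"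
    proof
      fix y assume "y \<in> ball x \<delta>"
      hence "\<bar>x - y\<bar> * real b ^ n < \<delta> * real b ^ n"
        using b_ge by (simp add: dist_real_def)
      also have "\<dots> \<le> 1" using n(1) \<delta> by (simp add: field_simps)
      finally have "\<bar>x * real b ^ n - y * real b ^ n\<bar> < 1"
        using b_ge by (simp add: abs_mult flip: left_diff_distrib)
      hence "\<lfloor>y * real b ^ n\<rfloor> - \<lfloor>x * real b ^ n\<rfloor> \<in> {-1, 0, 1}"
        by (simp, linarith)
      thus "y \<in> (\<Union>j\<in>{-1, 0, 1}. ?cell n (\<lfloor>x * real b ^ n\<rfloor> + j))"
        unfolding UN_iff mem_cell_iff by (rule bexI[rotated]) simp
    qed
    hence "measure \<mu> (ball x \<delta>) \<le> measure \<mu> (\<Union>j\<in>{-1, 0, 1}. ?cell n (\<lfloor>x * real b ^ n\<rfloor> + j))"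
      by (intro \<mu>.finite_measure_mono) auto
    also have "\<dots> \<le> (\<Sum>j\<in>{-1, 0, 1}. measure \<mu> (?cell n (\<lfloor>x * real b ^ n\<rfloor> + j)))"
      by (intro measure_UNION_le) auto
    also have "\<dots> \<le> (\<Sum>j\<in>{-1, 0, 1::int}. 1 / real m ^ n)"
    proof (rule sum_mono)
      fix j :: int
      show "measure \<mu> (?cell n (\<lfloor>x * real b ^ n\<rfloor> + j)) \<le> 1 / real m ^ n"
        using measure_cell[of "\<lfloor>x * real b ^ n\<rfloor> + j" n] by auto
    qed
    finally have upper: "measure \<mu> (ball x \<delta>) \<le> 3 / real m ^ n" by simp
    have "?cell (Suc n) \<lfloor>x * real b ^ Suc n\<rfloor> \<subseteq> ball x \<delta>"
    proof
      fix y assume "y \<in> ?cell (Suc n) \<lfloor>x * real b ^ Suc n\<rfloor>"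
      hence "\<lfloor>y * real b ^ Suc n\<rfloor> = \<lfloor>x * real b ^ Suc n\<rfloor>" unfolding mem_cell_iff .
      hence "\<bar>x * real b ^ Suc n - y * real b ^ Suc n\<bar> < 1" by linarith
      hence "\<bar>x - y\<bar> * real b ^ Suc n < 1"
        using b_ge by (simp add: abs_mult flip: left_diff_distrib)
      also have "1 < \<delta> * real b ^ Suc n" using n(2) \<delta> by (simp add: field_simps)
      finally show "y \<in> ball x \<delta>" using b_ge by (simp add: dist_real_def)
    qed
    hence "measure \<mu> (?cell (Suc n) \<lfloor>x * real b ^ Suc n\<rfloor>) \<le> measure \<mu> (ball x \<delta>)"
      by (intro \<mu>.finite_measure_mono) auto
    hence lower: "1 / real m ^ Suc n \<le> measure \<mu> (ball x \<delta>)" unfolding cell .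
    have pos: "0 < measure \<mu> (ball x \<delta>)"
      by (rule less_le_trans[OF _ lower]) (use m_ge in simp)
    have u: "ln (measure \<mu> (ball x \<delta>)) \<le> ln 3 - real n * ln (real m)"
    proof -
      have "ln (measure \<mu> (ball x \<delta>)) \<le> ln (3 / real m ^ n)"
        using upper pos m_ge by (subst ln_le_cancel_iff) auto
      thus ?thesis using m_ge by (simp add: ln_div ln_realpow)
    qed
    have l: "- (real n * ln (real m)) - ln (real m) \<le> ln (measure \<mu> (ball x \<delta>))"
    proof -
      have "ln (1 / real m ^ Suc n) \<le> ln (measure \<mu> (ball x \<delta>))"
        using lower pos m_ge by (subst ln_le_cancel_iff) auto
      moreover have "ln (1 / real m ^ Suc n) = - (real n * ln (real m)) - ln (real m)"
        using m_ge by (simp only: ln_div ln_realpow) (simp add: ln_div ln_realpow ln_mult algebra_simps)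
      ultimately show ?thesis by simp
    qed
    have lnb: "0 < ln (real b)" "0 < ln (real m)" "ln \<delta> < 0" using b_ge m_ge \<delta> by auto
    have "real n * ln (real b) \<le> - ln \<delta>"
    proof -
      have "ln (real b ^ n) \<le> ln (1 / \<delta>)" using n(1) b_ge \<delta> by (subst ln_le_cancel_iff) auto
      thus ?thesis using \<delta> b_ge by (simp add: ln_div ln_realpow)
    qed
    \<comment> \<open>Multiplying by \<open>?s\<close> trades \<open>ln b\<close> for
      \<open>ln m\<close>.\<close>
    hence n1: "real n * ln (real m) \<le> - (?s * ln \<delta>)"
      using lnb mult_right_mono[of "real n * ln (real b)" "- ln \<delta>" ?s] by (simp add: mult.commute)
    have "- ln \<delta> \<le> (real n + 1) * ln (real b)"
    proof -
      have "ln (1 / \<delta>) \<le> ln (real b ^ Suc n)" using n(2) b_ge \<delta> by (subst ln_le_cancel_iff) auto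
      moreover have "ln (real b ^ Suc n) = (real n + 1) * ln (real b)"
        using b_ge by (subst ln_realpow) (auto simp: algebra_simps)
      ultimately show ?thesis using \<delta> by (simp add: ln_div)
    qed
    hence n2: "- (?s * ln \<delta>) \<le> (real n + 1) * ln (real m)"
      using lnb mult_right_mono[of "- ln \<delta>" "(real n + 1) * ln (real b)" ?s] by (simp add: mult.commute)
    have distr: "(s + a / ln \<delta>) * ln \<delta> = s * ln \<delta> + a" for s a
      using lnb by (simp add: field_simps)
    have "(?s + (ln (real m) + ln 3) / ln \<delta>) * ln \<delta> \<ge> ln (measure \<mu> (ball x \<delta>))"
      using u n2 unfolding distr by (simp add: distrib_right)
    thus "?s + (ln (real m) + ln 3) / ln \<delta> \<le> ln (measure \<mu> (ball x \<delta>)) / ln \<delta>"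
      using lnb by (subst neg_le_divide_eq) auto
    have "(?s - ln (real m) / ln \<delta>) * ln \<delta> \<le> ln (measure \<mu> (ball x \<delta>))"
      using l n1 distr[of ?s "- ln (real m)"] by simp
    thus "ln (measure \<mu> (ball x \<delta>)) / ln \<delta> \<le> ?s - ln (real m) / ln \<delta>"
      using lnb by (subst neg_divide_le_eq) auto
  qed
  have ev: "\<forall>\<^sub>F \<delta> in at_right (0::real). 0 < \<delta> \<and> \<delta> < 1"
    by (auto simp: eventually_at_right_field intro!: exI[of _ 1])
  have lim: "((\<lambda>\<delta>. c / ln \<delta>) \<longlongrightarrow> 0) (at_right (0::real))" for c :: real
    by (rule tendsto_divide_0[OF tendsto_const filterlim_at_bot_imp_at_infinity[OF ln_at_0]])
  show ?case
  proof (rule tendsto_sandwich)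
    show "\<forall>\<^sub>F \<delta> in at_right 0. ?s + (ln (real m) + ln 3) / ln \<delta> \<le> ln (measure \<mu> (ball x \<delta>)) / ln \<delta>"
      using ev by eventually_elim (use bounds in auto)
    show "\<forall>\<^sub>F \<delta> in at_right 0. ln (measure \<mu> (ball x \<delta>)) / ln \<delta> \<le> ?s - ln (real m) / ln \<delta>"
      using ev by eventually_elim (use bounds in auto)
    show "((\<lambda>\<delta>. ?s + (ln (real m) + ln 3) / ln \<delta>) \<longlongrightarrow> ?s) (at_right 0)"
      using tendsto_add[OF tendsto_const lim, of ?s] by simp
    show "((\<lambda>\<delta>. ?s - ln (real m) / ln \<delta>) \<longlongrightarrow> ?s) (at_right 0)"
      using tendsto_diff[OF tendsto_const lim, of ?s] by simp
  qed
qed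

end

section \<open>Products of Dirichlet kernels\<close>

text \<open>Jordan's inequality: by concavity, the sine lies above its chord on
  \<open>[0, pi/2]\<close>.\<close>

lemma sin_pi_ge:
  fixes \<theta> :: real
  assumes "0 \<le> \<theta>" "\<theta> \<le> 1/2"
  shows "2 * \<theta> \<le> sin (pi * \<theta>)"
proof -
  have "concave_on {0..pi/2} sin"
    by (rule f''_le0_imp_concave[where f' = cos and f'' = "\<lambda>x. - sin x"])
       (auto intro!: derivative_eq_intros sin_ge_zero)
  from concave_onD[OF this, of "2 * \<theta>" 0 "pi/2"] show ?thesis
    using assms by (simp add: mult.commute)
qed

text \<open>Each dyadic block contributes at most 1. The \<open>max\<close> gives the index 0 the
  weight 1, matching the trivial bound on the kernel.\<close>

lemma sum_inverse_pow2: "(\<Sum>k<2^j. 1 / max 1 (real k)) \<le> 1 + real j"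
proof (induction j)
  case (Suc j)
  let ?h = "\<lambda>k::nat. 1 / max 1 (real k)"
  have "?h k \<le> 1 / 2 ^ j" if "k \<in> {2 ^ j..<2 ^ Suc j}" for k
  proof -
    have "2 ^ j \<le> k" using that by simp
    hence "real (2 ^ j) \<le> real k" by (simp only: of_nat_le_iff)
    hence "2 ^ j \<le> max 1 (real k)" by (simp only: of_nat_power of_nat_numeral le_max_iff_disj simp_thms)
    thus ?thesis by (simp add: frac_le)
  qed
  hence "sum ?h {2 ^ j..<2 ^ Suc j} \<le> (\<Sum>k\<in>{2 ^ j..<(2::nat) ^ Suc j}. 1 / 2 ^ j)"
    by (rule sum_mono)
  hence "sum ?h {2 ^ j..<2 ^ Suc j} \<le> 1" by simp
  moreover have "sum ?h {..<2 ^ Suc j} = sum ?h {..<2 ^ j} + sum ?h {2 ^ j..<2 ^ Suc j}"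
    unfolding lessThan_atLeast0 by (rule sum.atLeastLessThan_concat[symmetric]) simp_all
  ultimately show ?case using Suc by simp
qed simp

definition dirichlet :: "nat \<Rightarrow> real \<Rightarrow> real" where
  "dirichlet m \<theta> = cmod (\<Sum>i<m. cis (2 * pi * \<theta>) ^ i) / real m"

lemma dirichlet_nonneg: "0 \<le> dirichlet m \<theta>"
  by (simp add: dirichlet_def)

lemma dirichlet_le_1: "dirichlet m \<theta> \<le> 1"
proof -
  have "cmod (\<Sum>i<m. cis (2 * pi * \<theta>) ^ i) \<le> (\<Sum>i<m. cmod (cis (2 * pi * \<theta>) ^ i))"
    by (rule norm_sum)
  also have "\<dots> = real m" by (simp add: norm_power)
  finally show ?thesis by (cases "m = 0") (simp_all add: dirichlet_def)
qed

lemma dirichlet_add_nat: "dirichlet m (\<theta> + real k) = dirichlet m \<theta>"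
proof -
  have "cis (2 * pi * (\<theta> + real k)) = cis (2 * pi * \<theta>) * cis (2 * pi * real k)"
    by (simp only: cis_mult distrib_left)
  thus ?thesis by (simp add: dirichlet_def)
qed

text \<open>Geometric sum: the denominator has modulus
  \<open>2 * \<bar>sin (pi * \<theta>)\<bar>\<close>, the numerator at most 2. The product form also
  covers zeros of the sine.\<close>

lemma dirichlet_le: "real m * \<bar>sin (pi * \<theta>)\<bar> * dirichlet m \<theta> \<le> 1"
proof -
  let ?z = "cis (2 * pi * \<theta>)"
  have "2 * \<bar>sin (pi * \<theta>)\<bar> * cmod (\<Sum>i<m. ?z ^ i) = cmod (?z - 1) * cmod (\<Sum>i<m. ?z ^ i)"
    using dist_exp_i_1[of "2 * pi * \<theta>"] by (simp add: cis_conv_exp)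
  also have "\<dots> = cmod (?z ^ m - 1)" by (simp add: power_diff_1_eq norm_mult)
  also have "\<dots> \<le> cmod (?z ^ m) + cmod 1" by (rule norm_triangle_ineq4)
  also have "\<dots> = 2" by (simp add: norm_power)
  finally show ?thesis by (cases "m = 0") (simp_all add: dirichlet_def)
qed

text \<open>The factor 2 from Jordan's inequality absorbs the loss in passing from \<open>m\<close>
  to \<open>b \<le> 2 * m\<close>.\<close>

lemma dirichlet_le_inverse:
  assumes "0 < c" "0 < b" "b \<le> 2 * m" "2 * (c / real b) \<le> \<bar>sin (pi * \<theta>)\<bar>"
  shows "dirichlet m \<theta> \<le> 1 / c"
proof -
  have "c * dirichlet m \<theta> \<le> real m * (2 * (c / real b)) * dirichlet m \<theta>"
    using assms by (intro mult_right_mono dirichlet_nonneg) (simp add: field_simps)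
  also have "\<dots> \<le> real m * \<bar>sin (pi * \<theta>)\<bar> * dirichlet m \<theta>"
    using assms by (intro mult_right_mono mult_left_mono dirichlet_nonneg) auto
  also have "\<dots> \<le> 1" by (rule dirichlet_le)
  finally show ?thesis using assms by (simp add: field_simps)
qed

text \<open>A discrete form of the logarithmic growth of the kernel's norm: the \<open>k\<close>-th
  point is at distance at least \<open>k / b\<close> or \<open>(b - 1 - k) / b\<close> from the
  integers, which gives two harmonic sums.\<close>

lemma sum_dirichlet_le:
  assumes b: "b = 2 ^ j" "b \<le> 2 * m" and x: "0 \<le> x" "x < 1"
  shows "(\<Sum>k<b. dirichlet m ((x + real k) / real b)) \<le> 2 * (1 + real j)"
proof -
  let ?h = "\<lambda>k. 1 / max 1 (real k)"
  have b0: "0 < b" using b by simp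
  have "(\<Sum>k<b. dirichlet m ((x + real k) / real b)) \<le> (\<Sum>k<b. ?h k + ?h (b - Suc k))"
  proof (rule sum_mono)
    fix k assume k: "k \<in> {..<b}"
    let ?\<theta> = "(x + real k) / real b"
    have \<theta>: "0 \<le> ?\<theta>" "?\<theta> \<le> 1" using x k b0 by (auto simp: field_simps)
    have h: "0 \<le> ?h i" for i by simp
    show "dirichlet m ?\<theta> \<le> ?h k + ?h (b - Suc k)"
    proof (cases "?\<theta> \<le> 1/2")
      case True
      have "dirichlet m ?\<theta> \<le> ?h k"
      proof (cases "k = 0")
        case False
        have "2 * (real k / real b) \<le> 2 * ?\<theta>" using x b0 by (simp add: field_simps)
        also have "\<dots> \<le> sin (pi * ?\<theta>)" by (rule sin_pi_ge) (use \<theta> True in auto)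
        finally have "dirichlet m ?\<theta> \<le> 1 / real k"
          using False b0 b by (intro dirichlet_le_inverse[of _ b]) auto
        thus ?thesis using False by (simp add: max_def)
      qed (simp add: dirichlet_le_1)
      thus ?thesis using h[of "b - Suc k"] by linarith
    next
      case False
      have "dirichlet m ?\<theta> \<le> ?h (b - Suc k)"
      proof (cases "b - Suc k = 0")
        case nz: False
        have "2 * (real (b - Suc k) / real b) \<le> 2 * (1 - ?\<theta>)"
          using x k b0 by (simp add: field_simps of_nat_diff)
        also have "\<dots> \<le> sin (pi * (1 - ?\<theta>))" by (rule sin_pi_ge) (use \<theta> False in auto)
        also have "\<dots> = sin (pi * ?\<theta>)" by (simp add: right_diff_distrib)
        finally have "dirichlet m ?\<theta> \<le> 1 / real (b - Suc k)"
          using nz b0 b(2) by (intro dirichlet_le_inverse[of _ b]) simp_all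
        thus ?thesis using nz by (simp add: max_def)
      qed (simp add: dirichlet_le_1)
      thus ?thesis using h[of k] by linarith
    qed
  qed
  also have "\<dots> = 2 * (\<Sum>k<b. ?h k)"
    by (simp only: sum.distrib sum.nat_diff_reindex[of ?h] mult_2)
  also have "\<dots> \<le> 2 * (1 + real j)"
    using sum_inverse_pow2[of j] b by simp
  finally show ?thesis .
qed

definition dirichlet_prod :: "nat \<Rightarrow> nat \<Rightarrow> nat \<Rightarrow> real \<Rightarrow> real" where
  "dirichlet_prod m b n x = (\<Prod>j<n. dirichlet m (x / real b ^ Suc j))"

lemma dirichlet_prod_nonneg: "0 \<le> dirichlet_prod m b n x"
  unfolding dirichlet_prod_def by (intro prod_nonneg dirichlet_nonneg ballI)

text \<open>The factor with index \<open>j\<close> has period \<open>b ^ Suc j\<close>, a divisor of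
  \<open>b ^ n\<close>.\<close>

lemma dirichlet_prod_periodic:
  assumes "0 < b"
  shows "dirichlet_prod m b n (x + real k * real b ^ n) = dirichlet_prod m b n x"
  unfolding dirichlet_prod_def
proof (rule prod.cong)
  fix j assume "j \<in> {..<n}"
  hence "real b ^ n = real b ^ (n - Suc j) * real b ^ Suc j"
    by (subst power_add[symmetric]) simp
  hence "(x + real k * real b ^ n) / real b ^ Suc j = x / real b ^ Suc j + real (k * b ^ (n - Suc j))"
    using assms by (simp add: add_divide_distrib)
  thus "dirichlet m ((x + real k * real b ^ n) / real b ^ Suc j) = dirichlet m (x / real b ^ Suc j)"
    by (simp only: dirichlet_add_nat)
qed simp

text \<open>
  Splitting \<open>k = k\<^sub>0 + b ^ n * k\<^sub>1\<close>, the first \<open>n\<close> factors only depend on \<open>k\<^sub>0\<close>, and the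
  last one is summed over \<open>k\<^sub>1\<close>.
\<close>

lemma sum_dirichlet_prod_le:
  assumes "0 < b" "0 \<le> B"
    and B: "\<And>x. 0 \<le> x \<Longrightarrow> x < 1 \<Longrightarrow> (\<Sum>k<b. dirichlet m ((x + real k) / real b)) \<le> B"
  shows "(\<Sum>k<b^n. dirichlet_prod m b n (real k)) \<le> B ^ n"
proof (induction n)
  case (Suc n)
  let ?P = "dirichlet_prod m b"
  have "(\<Sum>k<b ^ Suc n. ?P (Suc n) (real k))
      = (\<Sum>k\<^sub>1<b. \<Sum>k = k\<^sub>1 * b ^ n..<k\<^sub>1 * b ^ n + b ^ n. ?P (Suc n) (real k))"
    by (simp add: sum.nat_group)
  also have "\<dots> = (\<Sum>k\<^sub>1<b. \<Sum>k\<^sub>0<b ^ n. ?P (Suc n) (real k\<^sub>0 + real k\<^sub>1 * real b ^ n))"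
  proof (rule sum.cong)
    fix k\<^sub>1
    show "(\<Sum>k = k\<^sub>1 * b ^ n..<k\<^sub>1 * b ^ n + b ^ n. ?P (Suc n) (real k))
        = (\<Sum>k\<^sub>0<b ^ n. ?P (Suc n) (real k\<^sub>0 + real k\<^sub>1 * real b ^ n))"
      using sum.shift_bounds_nat_ivl[of "\<lambda>k. ?P (Suc n) (real k)" 0 "k\<^sub>1 * b ^ n" "b ^ n"]
      by (simp add: add.commute atLeast0LessThan)
  qed simp
  also have "\<dots> = (\<Sum>k\<^sub>0<b ^ n. \<Sum>k\<^sub>1<b. ?P (Suc n) (real k\<^sub>0 + real k\<^sub>1 * real b ^ n))"
    by (rule sum.swap)
  also have "\<dots> = (\<Sum>k\<^sub>0<b ^ n. ?P n (real k\<^sub>0) *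
      (\<Sum>k\<^sub>1<b. dirichlet m ((real k\<^sub>0 / real b ^ n + real k\<^sub>1) / real b)))"
  proof (rule sum.cong)
    fix k\<^sub>0
    have "?P (Suc n) (real k\<^sub>0 + real k\<^sub>1 * real b ^ n)
        = ?P n (real k\<^sub>0) * dirichlet m ((real k\<^sub>0 / real b ^ n + real k\<^sub>1) / real b)" for k\<^sub>1
    proof -
      have "(real k\<^sub>0 + real k\<^sub>1 * real b ^ n) / real b ^ Suc n = (real k\<^sub>0 / real b ^ n + real k\<^sub>1) / real b"
        using assms(1) by (simp add: field_simps)
      moreover have "?P (Suc n) y = ?P n y * dirichlet m (y / real b ^ Suc n)" for y
        by (simp add: dirichlet_prod_def)
      ultimately show ?thesis by (simp only: dirichlet_prod_periodic[OF assms(1)])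
    qed
    thus "(\<Sum>k\<^sub>1<b. ?P (Suc n) (real k\<^sub>0 + real k\<^sub>1 * real b ^ n)) = ?P n (real k\<^sub>0) *
      (\<Sum>k\<^sub>1<b. dirichlet m ((real k\<^sub>0 / real b ^ n + real k\<^sub>1) / real b))"
      by (simp add: sum_distrib_left)
  qed simp
  also have "\<dots> \<le> (\<Sum>k\<^sub>0<b ^ n. ?P n (real k\<^sub>0) * B)"
  proof (intro sum_mono mult_left_mono B dirichlet_prod_nonneg)
    fix k assume "k \<in> {..<b ^ n}"
    hence "real k < real (b ^ n)" by (subst of_nat_less_iff) simp
    thus "real k / real b ^ n < 1" using assms(1) by simp
  qed simp
  also have "\<dots> \<le> B ^ n * B"
    unfolding sum_distrib_right[symmetric] using assms(2) Suc by (rule mult_right_mono[rotated])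
  finally show ?case by (simp add: mult.commute)
qed (simp add: dirichlet_prod_def)

section \<open>The Fourier transform of the digit measure\<close>

lemma cmod_fourier: "cmod (fourier \<mu> \<xi>) = cmod (char \<mu> (2 * pi * of_int \<xi>))"
proof -
  have "exp (- 2 * complex_of_real pi * \<i> * complex_of_real x * of_int \<xi>)
      = cnj (iexp (2 * pi * of_int \<xi> * x))" for x
    by (simp add: exp_cnj algebra_simps)
  hence "fourier \<mu> \<xi> = cnj (char \<mu> (2 * pi * of_int \<xi>))"
    unfolding fourier_def char_def by (simp only: Bochner_Integration.integral_cnj)
  thus ?thesis by simp
qed

context digit_system
begin

text \<open>The \<open>i\<close>-th map contributes the \<open>i\<close>-th power of one phase, and
  averaging these powers gives the kernel.\<close>

lemma char_digit_measure:
  "cmod (char \<mu> (2 * pi * x)) = dirichlet m (x / real b) * cmod (char \<mu> (2 * pi * (x / real b)))"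
proof -
  have "char \<mu> (2 * pi * x) =
      (\<Sum>i<m. LINT y|\<mu>. iexp (2 * pi * x * ((y + real i) / real b))) /\<^sub>R real m"
    unfolding char_def by (rule integral_digit_measure[of _ 1]) auto
  also have "(\<lambda>i. LINT y|\<mu>. iexp (2 * pi * x * ((y + real i) / real b)))
      = (\<lambda>i. cis (2 * pi * (x / real b)) ^ i * char \<mu> (2 * pi * (x / real b)))"
  proof
    fix i
    have "iexp (2 * pi * x * ((y + real i) / real b))
        = cis (2 * pi * (x / real b)) ^ i * iexp (2 * pi * (x / real b) * y)" for y
      unfolding cis_conv_exp[symmetric] Complex.DeMoivre cis_mult
      by (rule arg_cong[of _ _ cis]) (simp add: add_divide_distrib algebra_simps)
    thus "(LINT y|\<mu>. iexp (2 * pi * x * ((y + real i) / real b)))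
      = cis (2 * pi * (x / real b)) ^ i * char \<mu> (2 * pi * (x / real b))"
      unfolding char_def by (simp only: integral_mult_right_zero)
  qed
  finally show ?thesis
    by (simp add: dirichlet_def norm_mult divide_inverse flip: sum_distrib_right)
qed

text \<open>Iterate the functional equation \<open>n\<close> times and bound the leftover factor by
  1; convergence of the infinite product never enters.\<close>

lemma cmod_char_le_dirichlet_prod: "cmod (char \<mu> (2 * pi * x)) \<le> dirichlet_prod m b n x"
proof -
  have "cmod (char \<mu> (2 * pi * x))
      = dirichlet_prod m b n x * cmod (char \<mu> (2 * pi * (x / real b ^ n)))"
  proof (induction n)
    case (Suc n)
    show ?case using Suc char_digit_measure[of "x / real b ^ n"]
      by (simp add: dirichlet_prod_def mult_ac)
  qed (simp add: dirichlet_prod_def)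
  also have "\<dots> \<le> dirichlet_prod m b n x * 1"
    by (intro mult_left_mono \<mu>.cmod_char_le_1 dirichlet_prod_nonneg)
  finally show ?thesis by simp
qed

end

section \<open>Absolute sums of Fourier coefficients\<close>

lemma not_bigo_tendsto_0:
  fixes f g :: "'a \<Rightarrow> real"
  assumes "F \<noteq> bot" "f \<in> O[F](g)" "(g \<longlongrightarrow> 0) F" "\<forall>\<^sub>F x in F. 1 \<le> f x"
  shows False
proof -
  obtain c where "\<forall>\<^sub>F x in F. norm (f x) \<le> c * norm (g x)"
    using assms(2) by (auto elim: landau_o.bigE)
  hence "\<forall>\<^sub>F x in F. 1 \<le> c * norm (g x)"
    using assms(4) by eventually_elim auto
  moreover have "((\<lambda>x. c * norm (g x)) \<longlongrightarrow> c * norm (0::real)) F"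
    by (intro tendsto_intros assms)
  ultimately have "1 \<le> c * norm (0::real)"
    using assms(1) by (intro tendsto_lowerbound[of _ _ F]) auto
  thus False by simp
qed

lemma finite_int_abs_le: "finite {\<xi>::int. \<bar>real_of_int \<xi>\<bar> \<le> R}"
proof (rule finite_subset)
  show "{\<xi>. \<bar>real_of_int \<xi>\<bar> \<le> R} \<subseteq> {- \<lceil>R\<rceil>..\<lceil>R\<rceil>}"
    by (auto simp: abs_le_iff) linarith+
qed simp

section \<open>From absolute Fourier sums to spectral and thick measures\<close>

context real_distribution
begin

lemma fourier_0: "cmod (fourier M 0) = 1"
  by (simp add: cmod_fourier char_zero)

lemma cmod_fourier_le_1: "cmod (fourier M \<xi>) \<le> 1"
  unfolding cmod_fourier by (rule cmod_char_le_1)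

lemma cmod_fourier_minus: "cmod (fourier M (- \<xi>)) = cmod (fourier M \<xi>)"
proof -
  have "char M (- t) = cnj (char M t)" for t
  proof -
    have "iexp (- t * x) = cnj (iexp (t * x))" for x by (simp add: exp_cnj)
    thus ?thesis unfolding char_def by (simp only: Bochner_Integration.integral_cnj)
  qed
  thus ?thesis by (simp add: cmod_fourier)
qed

text \<open>The supremum dominates its members only if the set is bounded above. An exponent above 1
  would force the sums to tend to 0, although frequency 0 alone contributes 1.\<close>

lemma dim_l2_ge:
  assumes "0 < s" and bigo: "(\<lambda>R. \<Sum>\<xi> | \<bar>real_of_int \<xi>\<bar> \<le> R. (cmod (fourier M \<xi>))\<^sup>2)
       \<in> O[at_top](\<lambda>R. R powr (1 - s))"
  shows "s \<le> dim_l2 M"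
  unfolding dim_l2_def
proof (rule cSup_upper)
  show "bdd_above (insert 0 {s. 0 < s \<and> (\<lambda>R. \<Sum>\<xi> | \<bar>real_of_int \<xi>\<bar> \<le> R. (cmod (fourier M \<xi>))\<^sup>2)
       \<in> O[at_top](\<lambda>R. R powr (1 - s))})"
  proof (rule bdd_aboveI[of _ 1], rule ccontr)
    fix s :: real
    assume "s \<in> insert 0 {s. 0 < s \<and> (\<lambda>R. \<Sum>\<xi> | \<bar>real_of_int \<xi>\<bar> \<le> R. (cmod (fourier M \<xi>))\<^sup>2)
       \<in> O[at_top](\<lambda>R. R powr (1 - s))}" "\<not> s \<le> 1"
    hence s: "1 < s" "(\<lambda>R. \<Sum>\<xi> | \<bar>real_of_int \<xi>\<bar> \<le> R. (cmod (fourier M \<xi>))\<^sup>2)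
       \<in> O[at_top](\<lambda>R. R powr (1 - s))" by auto
    show False
    proof (rule not_bigo_tendsto_0[OF _ s(2)])
      show "((\<lambda>R. R powr (1 - s)) \<longlongrightarrow> 0) at_top"
        using s(1) by (intro tendsto_neg_powr filterlim_ident) auto
      show "\<forall>\<^sub>F R in at_top. 1 \<le> (\<Sum>\<xi> | \<bar>real_of_int \<xi>\<bar> \<le> R. (cmod (fourier M \<xi>))\<^sup>2)"
        using eventually_ge_at_top[of 0]
      proof eventually_elim
        case (elim R)
        have "(cmod (fourier M 0))\<^sup>2 \<le> (\<Sum>\<xi> | \<bar>real_of_int \<xi>\<bar> \<le> R. (cmod (fourier M \<xi>))\<^sup>2)"
          using elim by (intro member_le_sum finite_int_abs_le) auto
        thus ?case by (simp add: fourier_0)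
      qed
    qed simp
  qed
qed (use assms in simp)

text \<open>Boundedness again comes from frequency 0, which is always counted because
  \<open>0 powr _ = 0\<close>.\<close>

lemma dim_R_ge:
  assumes "spectral_exponent M \<kappa>"
  shows "\<kappa> \<le> dim_R M"
  unfolding dim_R_def
proof (rule cSup_upper)
  show "bdd_above (insert 0 {\<kappa>. spectral_exponent M \<kappa>})"
  proof (rule bdd_aboveI[of _ 1], rule ccontr)
    fix \<kappa> assume "\<kappa> \<in> insert 0 {\<kappa>. spectral_exponent M \<kappa>}" "\<not> \<kappa> \<le> 1"
    then obtain \<Delta> where \<kappa>: "1 < \<kappa>"
      "(\<lambda>N::nat. real (card {\<xi>::int. 0 \<le> \<xi> \<and> \<xi> \<le> int N \<and>
          cmod (fourier M \<xi>) \<ge> \<bar>real_of_int \<xi>\<bar> powr (- \<Delta>)})) \<in> O[at_top](\<lambda>N. real N powr (1 - \<kappa>))"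
      by (auto simp: spectral_exponent_def)
    show False
    proof (rule not_bigo_tendsto_0[OF _ \<kappa>(2)])
      show "((\<lambda>N. real N powr (1 - \<kappa>)) \<longlongrightarrow> 0) at_top"
        using \<kappa>(1) by (intro tendsto_neg_powr filterlim_real_sequentially) auto
      show "\<forall>\<^sub>F N in at_top. 1 \<le> real (card {\<xi>::int. 0 \<le> \<xi> \<and> \<xi> \<le> int N \<and>
          cmod (fourier M \<xi>) \<ge> \<bar>real_of_int \<xi>\<bar> powr (- \<Delta>)})"
      proof (rule always_eventually, rule allI)
        fix N
        let ?S = "{\<xi>::int. 0 \<le> \<xi> \<and> \<xi> \<le> int N \<and> cmod (fourier M \<xi>) \<ge> \<bar>real_of_int \<xi>\<bar> powr (- \<Delta>)}"
        have "finite ?S" by (rule finite_subset[of _ "{0..int N}"]) auto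
        hence "card {0::int} \<le> card ?S" by (rule card_mono) auto
        thus "1 \<le> real (card ?S)" by simp
      qed
    qed simp
  qed
qed (use assms in simp)

text \<open>
  Chebyshev's inequality in the form: if more than \<open>N powr (\<epsilon> + \<Delta>)\<close> frequencies had Fourier
  coefficient at least \<open>N powr (-\<Delta>)\<close>, the absolute sum would exceed \<open>N powr \<epsilon>\<close>.
\<close>

lemma spectral_exponent_of_fourier_sum:
  assumes C: "\<And>R. 1 \<le> R \<Longrightarrow> (\<Sum>\<xi> | \<bar>real_of_int \<xi>\<bar> \<le> R. cmod (fourier M \<xi>)) \<le> C * R powr \<epsilon>"
    and "1/2 < \<Delta>" "\<epsilon> + \<Delta> < 1"
  shows "spectral_exponent M (1 - (\<epsilon> + \<Delta>))"
  unfolding spectral_exponent_def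
proof (intro conjI exI)
  let ?S = "\<lambda>N. {\<xi>::int. 0 \<le> \<xi> \<and> \<xi> \<le> int N \<and> cmod (fourier M \<xi>) \<ge> \<bar>real_of_int \<xi>\<bar> powr (- \<Delta>)}"
  have "real (card (?S N)) \<le> C * real N powr (\<epsilon> + \<Delta>)" if N: "1 \<le> N" for N
  proof -
    have "real (card (?S N)) * real N powr (- \<Delta>) = (\<Sum>\<xi>\<in>?S N. real N powr (- \<Delta>))" by simp
    also have "\<dots> \<le> (\<Sum>\<xi>\<in>?S N. cmod (fourier M \<xi>))"
    proof (rule sum_mono)
      fix \<xi> assume \<xi>: "\<xi> \<in> ?S N"
      show "real N powr (- \<Delta>) \<le> cmod (fourier M \<xi>)"
      \<comment> \<open>At 0 the threshold is 0 by convention, so monotonicity of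
        \<open>powr\<close> fails there; the coefficient 1 is used directly.\<close>
      proof (cases "\<xi> = 0")
        case True
        thus ?thesis using N assms(2) by (simp add: fourier_0 powr_minus inverse_le_1_iff ge_one_powr_ge_zero)
      next
        case False
        hence "real N powr (- \<Delta>) \<le> \<bar>real_of_int \<xi>\<bar> powr (- \<Delta>)"
          using \<xi> assms(2) by (intro powr_mono2') auto
        thus ?thesis using \<xi> by (blast intro: order_trans)
      qed
    qed
    also have "\<dots> \<le> (\<Sum>\<xi> | \<bar>real_of_int \<xi>\<bar> \<le> real N. cmod (fourier M \<xi>))"
      by (intro sum_mono2 finite_int_abs_le) auto
    also have "\<dots> \<le> C * real N powr \<epsilon>" using N by (intro C) simp
    finally have "real (card (?S N)) * real N powr (- \<Delta>) * real N powr \<Delta> \<le> C * real N powr \<epsilon> * real N powr \<Delta>"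
      by (rule mult_right_mono) simp
    thus ?thesis using N by (simp add: mult.assoc flip: powr_add)
  qed
  thus "(\<lambda>N. real (card (?S N))) \<in> O[at_top](\<lambda>N. real N powr (1 - (1 - (\<epsilon> + \<Delta>))))"
    by (intro bigoI[of _ C] eventually_sequentiallyI[of 1]) simp
qed (use assms in auto)

lemma spectral_thick_of_fourier_sum:
  assumes C: "\<And>R. 1 \<le> R \<Longrightarrow> (\<Sum>\<xi> | \<bar>real_of_int \<xi>\<bar> \<le> R. cmod (fourier M \<xi>)) \<le> C * R powr \<epsilon>"
    and "\<epsilon> < 1/4"
  shows "spectral M" "thick M"
proof -
  have "spectral_exponent M (1 - (\<epsilon> + (3/4 - \<epsilon>)))"
    by (rule spectral_exponent_of_fourier_sum[OF C]) (use assms(2) in auto)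
  hence sp: "spectral_exponent M (1/4)" by simp
  thus "spectral M" by (auto simp: spectral_def)
  have "1 - \<epsilon> \<le> dim_l2 M"
  proof (rule dim_l2_ge)
    show "(\<lambda>R. \<Sum>\<xi> | \<bar>real_of_int \<xi>\<bar> \<le> R. (cmod (fourier M \<xi>))\<^sup>2) \<in> O[at_top](\<lambda>R. R powr (1 - (1 - \<epsilon>)))"
    proof (intro bigoI[of _ C] eventually_mono[OF eventually_ge_at_top[of 1]])
      fix R :: real assume R: "1 \<le> R"
      have "(\<Sum>\<xi> | \<bar>real_of_int \<xi>\<bar> \<le> R. (cmod (fourier M \<xi>))\<^sup>2)
          \<le> (\<Sum>\<xi> | \<bar>real_of_int \<xi>\<bar> \<le> R. cmod (fourier M \<xi>))"
        \<comment> \<open>Coefficients have modulus at most 1, so squaring only decreases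
          them.\<close>
        by (intro sum_mono) (simp add: power2_eq_square mult_left_le cmod_fourier_le_1)
      also have "\<dots> \<le> C * R powr \<epsilon>" by (rule C[OF R])
      finally show "norm (\<Sum>\<xi> | \<bar>real_of_int \<xi>\<bar> \<le> R. (cmod (fourier M \<xi>))\<^sup>2)
          \<le> C * norm (R powr (1 - (1 - \<epsilon>)))"
        by (simp add: sum_nonneg)
    qed
  qed (use assms(2) in simp)
  thus "thick M" using dim_R_ge[OF sp] assms(2) by (simp add: thick_def)
qed

end

context digit_system
begin

text \<open>With \<open>b ^ n \<le> R < b ^ Suc n\<close>, the sum over
  \<open>[0, b ^ Suc n)\<close> is at most the power \<open>Suc n\<close> of
  \<open>b powr \<epsilon>\<close>. One factor is the overshoot beyond \<open>R\<close>, and the 2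
  accounts for negative frequencies.\<close>

lemma fourier_sum_le:
  assumes \<epsilon>: "0 \<le> \<epsilon>"
    and B: "\<And>x. 0 \<le> x \<Longrightarrow> x < 1 \<Longrightarrow> (\<Sum>k<b. dirichlet m ((x + real k) / real b)) \<le> real b powr \<epsilon>"
    and R: "1 \<le> R"
  shows "(\<Sum>\<xi> | \<bar>real_of_int \<xi>\<bar> \<le> R. cmod (fourier \<mu> \<xi>)) \<le> 2 * real b powr \<epsilon> * R powr \<epsilon>"
proof -
  let ?F = "\<lambda>\<xi>. cmod (fourier \<mu> \<xi>)"
  obtain n where n: "real b ^ n \<le> R" "R < real b ^ Suc n"
    using ex_power_interval[of "real b" R] b_ge R by auto
  have pos: "(\<Sum>\<xi>\<in>int ` {..<b ^ Suc n}. ?F \<xi>) \<le> (real b powr \<epsilon>) ^ Suc n"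
  proof -
    have "(\<Sum>\<xi>\<in>int ` {..<b ^ Suc n}. ?F \<xi>) = (\<Sum>k<b ^ Suc n. ?F (int k))"
      by (subst sum.reindex) (auto simp: inj_on_def)
    also have "\<dots> \<le> (\<Sum>k<b ^ Suc n. dirichlet_prod m b (Suc n) (real k))"
      unfolding cmod_fourier by (intro sum_mono) (simp add: cmod_char_le_dirichlet_prod)
    also have "\<dots> \<le> (real b powr \<epsilon>) ^ Suc n"
      using b_ge B by (intro sum_dirichlet_prod_le) auto
    finally show ?thesis .
  qed
  have neg: "(\<Sum>\<xi>\<in>uminus ` int ` {..<b ^ Suc n}. ?F \<xi>) = (\<Sum>\<xi>\<in>int ` {..<b ^ Suc n}. ?F \<xi>)"
    by (subst sum.reindex) (auto simp: inj_on_def \<mu>.cmod_fourier_minus)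
  have "{\<xi>. \<bar>real_of_int \<xi>\<bar> \<le> R} \<subseteq> int ` {..<b ^ Suc n} \<union> uminus ` int ` {..<b ^ Suc n}"
  proof
    fix \<xi> :: int assume "\<xi> \<in> {\<xi>. \<bar>real_of_int \<xi>\<bar> \<le> R}"
    hence "real_of_int \<bar>\<xi>\<bar> < real_of_int (int (b ^ Suc n))" using n(2) by simp
    hence "\<bar>\<xi>\<bar> < int (b ^ Suc n)" by linarith
    hence "nat \<bar>\<xi>\<bar> < b ^ Suc n" by linarith
    hence "nat \<bar>\<xi>\<bar> \<in> {..<b ^ Suc n}" by (simp only: lessThan_iff)
    moreover have "\<xi> = int (nat \<bar>\<xi>\<bar>) \<or> \<xi> = - int (nat \<bar>\<xi>\<bar>)" by linarith
    ultimately show "\<xi> \<in> int ` {..<b ^ Suc n} \<union> uminus ` int ` {..<b ^ Suc n}" by blast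
  qed
  hence "(\<Sum>\<xi> | \<bar>real_of_int \<xi>\<bar> \<le> R. ?F \<xi>) \<le> (\<Sum>\<xi>\<in>int ` {..<b ^ Suc n} \<union> uminus ` int ` {..<b ^ Suc n}. ?F \<xi>)"
    by (intro sum_mono2) auto
  also have "\<dots> \<le> (\<Sum>\<xi>\<in>int ` {..<b ^ Suc n}. ?F \<xi>) + (\<Sum>\<xi>\<in>uminus ` int ` {..<b ^ Suc n}. ?F \<xi>)"
    by (subst sum.union_inter[symmetric]) (auto intro!: sum_nonneg)
  also have "\<dots> \<le> 2 * (real b powr \<epsilon>) ^ Suc n" unfolding neg using pos by simp
  also have "(real b powr \<epsilon>) ^ Suc n = real b powr \<epsilon> * (real b ^ n) powr \<epsilon>"
    using b_ge by (simp add: powr_realpow[symmetric] powr_powr powr_power mult.commute)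
  also have "\<dots> \<le> real b powr \<epsilon> * R powr \<epsilon>"
    using n(1) \<epsilon> b_ge by (intro mult_left_mono powr_mono2) auto
  finally show ?thesis by simp
qed

end

theorem theorem1p6:
  "\<exists>(\<mu>::real measure) d. self_similar_measure \<mu> \<and> measure \<mu> {0..1} = 1 \<and>
     spectral \<mu> \<and> thick \<mu> \<and> has_dim_H \<mu> d \<and> 1/2 < d \<and> d < 1"
proof -
  \<comment> \<open>A power of 2 suits the dyadic bound, and 5 divides 30:
    \<open>2 * (1 + 30) = 62 \<le> 2 ^ 6 = b powr (1/5)\<close>, with
    \<open>1/5 < 1/4\<close>.\<close>
  define b m :: nat where "b = 2 ^ 30" and "m = b - 1"
  interpret digit_system m b by unfold_locales (simp_all add: b_def m_def)
  have B: "(\<Sum>k<b. dirichlet m ((x + real k) / real b)) \<le> real b powr (1/5)"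
    if "0 \<le> x" "x < 1" for x
  proof -
    have "(\<Sum>k<b. dirichlet m ((x + real k) / real b)) \<le> 2 * (1 + real 30)"
      by (rule sum_dirichlet_le) (use that in \<open>simp_all add: b_def m_def\<close>)
    also have "\<dots> \<le> 2 ^ 6" by simp
    also have "(2::real) ^ 6 = ((2 ^ 6) ^ 5) powr (1/5)"
      by (subst powr_realpow[symmetric]) (simp_all only: powr_powr, simp_all)
    also have "((2::real) ^ 6) ^ 5 = real b" by (simp add: b_def)
    finally show ?thesis .
  qed
  have st: "spectral \<mu>" "thick \<mu>"
    by (rule \<mu>.spectral_thick_of_fourier_sum[OF fourier_sum_le[OF _ B]]; simp)+
  \<comment> \<open>Equivalent to dimension above \<open>1/2\<close>; \<open>m < b\<close> keeps it
    below 1.\<close>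
  have "b < m ^ 2" by (simp add: b_def m_def)
  hence "ln (real b) < ln (real (m ^ 2))" using b_ge m_ge
    by (subst ln_less_cancel_iff) (simp_all only: of_nat_less_iff of_nat_power, simp_all)
  also have "\<dots> = 2 * ln (real m)" using m_ge by (simp add: ln_realpow)
  finally have "1/2 < ln (real m) / ln (real b)" using b_ge by (simp add: field_simps)
  moreover have "ln (real m) / ln (real b) < 1"
    using m_less_b m_ge b_ge by simp
  ultimately show ?thesis
    using self_similar_digit_measure measure_unit_interval st has_dim_H_digit_measure by blast
qed

end
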